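(* Let $G=\mathbb{Z}_p\times\mathbb{Z}_q\times\mathbb{Z}_r$ for distinct odd primes $p$, $q$ and $r$, let $S$ be a proper subset of $G\setminus\{0\}$ that generates $G$, and let $S_0=S\cup\{0\}$. Let $0\in C\subseteq G$. Then $C$ is a perfect code in $\mathrm{Cay}(G,S)$ if and only if, for some integer parameters, $(S_0,C)$ is one of the following pairs: (1) $S_0=\{(i,\alpha_i,\beta_i)\mid i\in[p]\}$, $C=\{(0,i,j)\mid i\in[q],j\in[r]\}$; (2) $S_0=\{(\alpha_i,i,\beta_i)\mid i\in[q]\}$, $C=\{(i,0,j)\mid i\in[p],j\in[r]\}$; (3) $S_0=\{(\alpha_i,\beta_i,i)\mid i\in[r]\}$, $C=\{(i,j,0)\mid i\in[p],j\in[q]\}$; (4) $S_0=\{(j,i,\alpha_i)\mid i\in[q],j\in[p]\}$, $C=\{(\lambda_i,0,i)\mid i\in[r]\}$; (5) $S_0=\{(i,j,\alpha_i)\mid i\in[p],j\in[q]\}$, $C=\{(0,\lambda_i,i)\mid i\in[r]\}$; (6) $S_0=\{(j,\alpha_i,i)\mid i\in[r],j\in[p]\}$, $C=\{(\lambda_i,i,0)\mid i\in[q]\}$; (7) $S_0=\{(i,\alpha_i,j)\mid i\in[p],j\in[r]\}$, $C=\{(0,i,\lambda_i)\mid i\in[q]\}$; (8) $S_0=\{(\alpha_i,j,i)\mid i\in[r],j\in[q]\}$, $C=\{(i,\lambda_i,0)\mid i\in[p]\}$; (9) $S_0=\{(\alpha_i,i,j)\mid i\in[q],j\in[r]\}$,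 $C=\{(i,0,\lambda_i)\mid i\in[p]\}$; (10) $S_0=\{(i,j,\alpha_{ij})\mid i\in[p],j\in[q]\}$, $C=\{(0,0,i)\mid i\in[r]\}$; (11) $S_0=\{(i,\alpha_{ij},j)\mid i\in[p],j\in[r]\}$, $C=\{(0,i,0)\mid i\in[q]\}$; (12) $S_0=\{(\alpha_{ij},i,j)\mid i\in[q],j\in[r]\}$, $C=\{(i,0,0)\mid i\in[p]\}$.
   Context: Groups are finite abelian, written additively; $\mathbb{Z}_n$ is the group of integers modulo $n$ and $[n]=\{0,1,\dots,n-1\}$; integers in coordinates are read modulo the relevant modulus. For $S\subseteq G\setminus\{0\}$, $\mathrm{Cay}(G,S)$ is the directed graph with vertex set $G$ and an arc from $x$ to $y$ if and only if $y-x\in S$ ($S$ is not assumed to be inverse-closed). A subset $C\subseteq G$ is a perfect code in $\mathrm{Cay}(G,S)$ if the sets $\{c\}\cup\{v:\text{there is an arc from } c \text{ to } v\}$, $c\in C$, form a partition of $G$. Greek letters with subscripts denote arbitrary integers, one for each value of the displayed indices, subject only to being $0$ when all subscripts are $0$; different letters (or index patterns) denote independent families. *)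

theory Defs
  imports
    "HOL-Algebra.Elementary_Groups"
    "HOL-Algebra.Generated_Groups"
    "HOL-Library.Disjoint_Sets"
    "HOL-Computational_Algebra.Primes"
    "Graph_Theory.Digraph"
begin

text \<open>Groups of HOL-Algebra are written multiplicatively: \<open>\<one>\<close> is the zero element,
  and \<open>y \<otimes> inv x\<close> is \<open>y - x\<close>.\<close>

definition Cay :: "('a, 'b) monoid_scheme \<Rightarrow> 'a set \<Rightarrow> ('a, 'a \<times> 'a) pre_digraph" where
  "Cay G S =
    \<lparr>verts = carrier G,
     arcs = {(x, y). x \<in> carrier G \<and> y \<in> carrier G \<and> y \<otimes>\<^bsub>G\<^esub> inv\<^bsub>G\<^esub> x \<in> S},
     tail = fst,
     head = snd\<rparr>"

definition closed_out_nbhd :: "('a, 'b) pre_digraph \<Rightarrow> 'a \<Rightarrow> 'a set" where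
  "closed_out_nbhd D c = {c} \<union> {v. c \<rightarrow>\<^bsub>D\<^esub> v}"

text \<open>The partition is indexed by \<open>C\<close>: distinct codewords with equal closed
  neighbourhoods are excluded, which a condition on the mere set of neighbourhoods would
  not do. The blocks are never empty.\<close>

definition perfect_code :: "('a, 'b) pre_digraph \<Rightarrow> 'a set \<Rightarrow> bool" where
  "perfect_code D C \<longleftrightarrow>
     C \<subseteq> verts D \<and>
     disjoint_family_on (closed_out_nbhd D) C \<and>
     (\<Union>c\<in>C. closed_out_nbhd D c) = verts D"

definition Z3 :: "nat \<Rightarrow> nat \<Rightarrow> nat \<Rightarrow> (int \<times> int \<times> int) monoid" where
  "Z3 p q r = integer_mod_group p \<times>\<times> integer_mod_group q \<times>\<times> integer_mod_group r"

text \<open>The element of \<open>Z3 p q r\<close> with the given integer coordinates, each read modulo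
  the relevant modulus.\<close>

definition red3 :: "nat \<Rightarrow> nat \<Rightarrow> nat \<Rightarrow> int \<times> int \<times> int \<Rightarrow> int \<times> int \<times> int" where
  "red3 p q r = (\<lambda>(x, y, z). (x mod int p, y mod int q, z mod int r))"

text \<open>The index set \<open>[n] = {0, 1, ..., n - 1}\<close>, as a set of integers.\<close>

definition idx :: "nat \<Rightarrow> int set" where
  "idx n = {0..<int n}"

end

theory Submission
  imports Defs "HOL-Number_Theory.Cong"
begin

text \<open>
  A perfect code \<open>C\<close> containing the identity is the same as a tiling of the group by
  \<open>S0 = S \<union> {\<one>}\<close> and \<open>C\<close>: every element is \<open>s \<otimes> c\<close> for exactly one pair. The sizes of the two
  factors multiply to \<open>p * q * r\<close>, and since neither factor is trivial, one of them has prime size.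

  The engine is a theorem of Tijdeman and Sands (\<open>tiling_power\<close>): if \<open>A\<close> and \<open>B\<close> tile a finite
  abelian group and \<open>n\<close> is prime to \<open>card A\<close>, then the \<open>n\<close>-th powers of \<open>A\<close> still tile together with
  \<open>B\<close>. For a prime \<open>n\<close> this is the freshman's dream modulo \<open>n\<close> in the group ring, followed by a
  count. Because \<open>n\<close> need not be prime to the order of the group, the Chinese remainder theorem lets
  one choose its residues modulo \<open>p\<close>, \<open>q\<close>, \<open>r\<close> independently, the only restriction coming from the
  primes dividing \<open>card A\<close> (\<open>tiling_congD\<close>).

  Let \<open>card A = p\<close>. Multipliers 1, 0, 0 on \<open>A\<close>, and 0, 1, 1 on \<open>B\<close>, show that \<open>A\<close> is a graph
  \<open>(i, \<alpha> i, \<beta> i)\<close> over the first coordinate and \<open>B\<close> a graph \<open>(l j k, j, k)\<close> over the other two. If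
  \<open>\<alpha>\<close> is not constant and \<open>l\<close> depends on \<open>j\<close>, a nonzero difference in \<open>A\<close> can be scaled,
  coordinate by coordinate, to a difference in \<open>B\<close>, a contradiction; so \<open>\<alpha>\<close> vanishes or \<open>l\<close> does not
  depend on \<open>j\<close>, and likewise for \<open>\<beta>\<close> and \<open>k\<close> (\<open>tiling_dichotomy\<close>). These conditions are also
  sufficient (\<open>graphs_imp_tiling\<close>). They leave four shapes. When \<open>S0\<close> is the factor of size \<open>p\<close>, three of
  them put \<open>S0\<close> into a coordinate plane, so that \<open>S\<close> would not generate the group; when \<open>C\<close> is,
  one of them does. Each prime thus contributes one case and three cases, twelve in all.
\<close>

section \<open>Powers of a factor of a group tiling\<close>

text \<open>The element \<open>\<Sum>i\<in>I. u i\<close> of the group ring, acting on integer functions by translations. The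
  family, rather than its range, carries the multiplicities, so that \<open>i \<mapsto> (u i)\<^sup>n\<close> may be substituted for
  \<open>u\<close> before it is known to be injective.\<close>

definition shift_sum ::
    "('a, 'b) monoid_scheme \<Rightarrow> ('i \<Rightarrow> 'a) \<Rightarrow> 'i set \<Rightarrow> ('a \<Rightarrow> int) \<Rightarrow> 'a \<Rightarrow> int" where
  "shift_sum G u I f y = (\<Sum>i\<in>I. f (y \<otimes>\<^bsub>G\<^esub> u i))"

lemma pascal_sum:
  fixes g :: "nat \<Rightarrow> int"
  shows "(\<Sum>k\<le>n. int (n choose k) * g (Suc k)) + (\<Sum>k\<le>n. int (n choose k) * g k)
       = (\<Sum>k\<le>Suc n. int (Suc n choose k) * g k)"
proof -
  have "(\<Sum>k\<le>n. int (n choose k) * g k) = (\<Sum>k\<le>Suc n. int (n choose k) * g k)"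
    by (simp add: binomial_eq_0)
  also have "\<dots> = g 0 + (\<Sum>k\<le>n. int (n choose Suc k) * g (Suc k))"
    by (subst sum.atMost_Suc_shift) simp
  finally show ?thesis
    unfolding sum.atMost_Suc_shift[of _ n] by (simp add: sum.distrib algebra_simps)
qed

context comm_group
begin

text \<open>The binomial theorem for the sum of two commuting operators, the one for \<open>I\<close> and the
  translation by \<open>u j\<close>.\<close>

lemma shift_sum_power_insert:
  assumes "finite I" "j \<notin> I" "u \<in> insert j I \<rightarrow> carrier G" "y \<in> carrier G"
  shows "(shift_sum G u (insert j I) ^^ n) f y
       = (\<Sum>k\<le>n. int (n choose k) * (shift_sum G u I ^^ k) f (y \<otimes> u j [^] (n - k)))"
  using assms(4)
proof (induction n arbitrary: y)
  case 0
  then show ?case by simp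
next
  case (Suc n)
  let ?T = "shift_sum G u I"
  let ?g = "\<lambda>k. (?T ^^ k) f (y \<otimes> u j [^] (Suc n - k))"
  have uj: "u j \<in> carrier G" and uI: "\<And>i. i \<in> I \<Longrightarrow> u i \<in> carrier G"
    using assms(3) by auto
  have move: "(y \<otimes> u i) \<otimes> u j [^] m = (y \<otimes> u j [^] m) \<otimes> u i" if "i \<in> I" for i and m :: nat
    using uj uI[OF that] Suc.prems by (simp add: m_ac)
  have "(\<Sum>i\<in>I. (shift_sum G u (insert j I) ^^ n) f (y \<otimes> u i))
      = (\<Sum>i\<in>I. \<Sum>k\<le>n. int (n choose k) * (?T ^^ k) f ((y \<otimes> u j [^] (n - k)) \<otimes> u i))"
    by (intro sum.cong refl) (simp add: Suc uI move)
  also have "\<dots> = (\<Sum>k\<le>n. int (n choose k) * ?g (Suc k))"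
    by (subst sum.swap) (simp add: sum_distrib_left shift_sum_def)
  finally have 1: "(\<Sum>i\<in>I. (shift_sum G u (insert j I) ^^ n) f (y \<otimes> u i))
      = (\<Sum>k\<le>n. int (n choose k) * ?g (Suc k))" .
  have absorb: "(y \<otimes> u j) \<otimes> u j [^] (n - k) = y \<otimes> u j [^] (Suc n - k)" if "k \<le> n" for k
    using uj Suc.prems that by (simp add: Suc_diff_le m_ac)
  have 2: "(shift_sum G u (insert j I) ^^ n) f (y \<otimes> u j) = (\<Sum>k\<le>n. int (n choose k) * ?g k)"
    using uj Suc.prems by (simp add: Suc.IH absorb)
  have "(shift_sum G u (insert j I) ^^ Suc n) f y
      = (shift_sum G u (insert j I) ^^ n) f (y \<otimes> u j)
        + (\<Sum>i\<in>I. (shift_sum G u (insert j I) ^^ n) f (y \<otimes> u i))"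
    using assms(1,2) by (simp add: shift_sum_def[of G u "insert j I"])
  also have "\<dots> = (\<Sum>k\<le>Suc n. int (Suc n choose k) * ?g k)"
    unfolding 1 2 using pascal_sum[of n ?g] by simp
  finally show ?case .
qed

text \<open>In characteristic \<open>l\<close> the \<open>l\<close>-th power of a sum of commuting translations is the sum of their
  \<open>l\<close>-th powers: the mixed binomial coefficients vanish.\<close>

lemma shift_sum_freshman:
  assumes l: "prime l" and "finite I" "u \<in> I \<rightarrow> carrier G" "y \<in> carrier G"
  shows "[(shift_sum G u I ^^ l) f y = shift_sum G (\<lambda>i. u i [^] l) I f y] (mod int l)"
  using assms(2-)
proof (induction I rule: finite_induct)
  case empty
  have "l = Suc (l - 1)" using prime_gt_0_nat[OF l] by simp
  then have "(shift_sum G u {} ^^ l) f y = 0"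
    by (metis comp_apply funpow.simps(2) shift_sum_def sum.empty)
  then show ?case by (simp only: shift_sum_def[of G "\<lambda>i. u i [^] l"]) simp
next
  case (insert j I)
  let ?g = "\<lambda>k. (shift_sum G u I ^^ k) f (y \<otimes> u j [^] (l - k))"
  have uj: "u j \<in> carrier G" and uI: "u \<in> I \<rightarrow> carrier G" using insert.prems by auto
  have "{..l} = insert 0 (insert l {1..<l})"
    using prime_gt_0_nat[OF l] by auto
  then have "(shift_sum G u (insert j I) ^^ l) f y
      = ?g 0 + ?g l + (\<Sum>k\<in>{1..<l}. int (l choose k) * ?g k)"
    using shift_sum_power_insert[OF insert.hyps insert.prems(1,2), of l f] prime_gt_0_nat[OF l]
    by simp
  moreover have "int l dvd (\<Sum>k\<in>{1..<l}. int (l choose k) * ?g k)"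
    using l by (intro dvd_sum dvd_mult2) (auto intro!: dvd_choose_prime)
  ultimately have "[(shift_sum G u (insert j I) ^^ l) f y = ?g 0 + ?g l] (mod int l)"
    by (simp add: cong_iff_dvd_diff)
  also have "[?g 0 + ?g l = f (y \<otimes> u j [^] l) + shift_sum G (\<lambda>i. u i [^] l) I f y] (mod int l)"
    using insert.IH[OF uI insert.prems(2)] insert.prems(2) by (intro cong_add) simp_all
  finally show ?case
    using insert.hyps by (simp add: shift_sum_def[of G "\<lambda>i. u i [^] l"])
qed

text \<open>Let \<open>f\<close> be the indicator function of the inverses of \<open>B\<close>. That every element has exactly one
  representation \<open>u i \<otimes> b\<close> says that \<open>shift_sum G u I\<close> sends \<open>f\<close> to the constant 1, so its
  \<open>l\<close>-th iterate sends \<open>f\<close> to a power of \<open>card I\<close>, which is nonzero modulo \<open>l\<close>. By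
  \<open>shift_sum_freshman\<close> the number of representations with \<open>(u i)\<^sup>l\<close> in place of \<open>u i\<close> is then nonzero
  modulo \<open>l\<close>, hence positive, for every element. There are only as many pairs as elements, so
  each element has exactly one such representation.\<close>

lemma tiling_prime_power:
  assumes fin: "finite (carrier G)" and l: "prime l" "\<not> l dvd card I"
    and u: "u \<in> I \<rightarrow> carrier G" and B: "B \<subseteq> carrier G" and I: "finite I"
    and bij: "bij_betw (\<lambda>(i, b). u i \<otimes> b) (I \<times> B) (carrier G)"
  shows "bij_betw (\<lambda>(i, b). u i [^] l \<otimes> b) (I \<times> B) (carrier G)"
proof -
  let ?f = "\<lambda>y. of_bool (inv y \<in> B) :: int"
  have one: "shift_sum G u I ?f y = 1" if y: "y \<in> carrier G" for y
  proof -
    have "inv y \<in> (\<lambda>(i, b). u i \<otimes> b) ` (I \<times> B)"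
      using bij inv_closed[OF y] by (simp add: bij_betw_def)
    then obtain i b where ib: "i \<in> I" "b \<in> B" "u i \<otimes> b = inv y" by auto
    have "inv (y \<otimes> u i') \<in> B \<longleftrightarrow> i' = i" if i': "i' \<in> I" for i'
    proof
      have c: "u i' \<in> carrier G" using u i' by auto
      have e: "u i' \<otimes> inv (y \<otimes> u i') = inv y"
        using y c by (simp add: inv_mult m_lcomm[of "u i'"])
      {
        assume "inv (y \<otimes> u i') \<in> B"
        then show "i' = i"
          using bij ib i' e unfolding bij_betw_def inj_on_def by fastforce
      }
      assume "i' = i"
      moreover have "b \<in> carrier G" using ib B by auto
      ultimately have "b = inv (y \<otimes> u i')"
        using e ib c y by (metis inv_closed Units_l_cancel Units_eq m_closed)
      then show "inv (y \<otimes> u i') \<in> B" using ib by simp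
    qed
    then have "shift_sum G u I ?f y = (\<Sum>i'\<in>I. of_bool (i' = i))"
      unfolding shift_sum_def by (intro sum.cong) auto
    then show ?thesis using ib I by simp
  qed
  have pow: "(shift_sum G u I ^^ Suc n) ?f y = int (card I) ^ n" if "y \<in> carrier G" for n y
    using that
  proof (induction n arbitrary: y)
    case (Suc n)
    have "(shift_sum G u I ^^ Suc (Suc n)) ?f y
        = (\<Sum>i\<in>I. (shift_sum G u I ^^ Suc n) ?f (y \<otimes> u i))"
      by (subst funpow.simps(2))
        (simp only: comp_apply shift_sum_def[of G u I "(shift_sum G u I ^^ Suc n) ?f"])
    also have "\<dots> = (\<Sum>i\<in>I. int (card I) ^ n)"
      using Suc u by (intro sum.cong refl Suc.IH) auto
    finally show ?case by simp
  qed (simp add: one)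
  have cover: "y \<in> (\<lambda>(i, b). u i [^] l \<otimes> b) ` (I \<times> B)" if y: "y \<in> carrier G" for y
  proof -
    have "l = Suc (l - 1)" using prime_gt_0_nat[OF l(1)] by simp
    then have "(shift_sum G u I ^^ l) ?f (inv y) = int (card I) ^ (l - 1)"
      using pow[of "inv y" "l - 1"] y by simp
    then have "[int (card I) ^ (l - 1) = shift_sum G (\<lambda>i. u i [^] l) I ?f (inv y)] (mod int l)"
      using shift_sum_freshman[OF l(1) I u, of "inv y" ?f] y by simp
    moreover have "\<not> int l dvd int (card I) ^ (l - 1)"
      using l by (metis of_nat_dvd_iff of_nat_power prime_dvd_power_nat)
    ultimately have "shift_sum G (\<lambda>i. u i [^] l) I ?f (inv y) \<noteq> 0"
      by (metis cong_0_iff)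
    then obtain i where i: "i \<in> I" "inv (inv y \<otimes> u i [^] l) \<in> B"
      unfolding shift_sum_def by (auto elim!: sum.not_neutral_contains_not_neutral)
    have c: "u i \<in> carrier G" using u i by auto
    have "u i [^] l \<otimes> inv (inv y \<otimes> u i [^] l) = y"
      using y c by (simp add: inv_mult m_lcomm)
    then show ?thesis using i by (auto intro!: image_eqI[of _ _ "(i, inv (inv y \<otimes> u i [^] l))"])
  qed
  have into: "(\<lambda>(i, b). u i [^] l \<otimes> b) ` (I \<times> B) \<subseteq> carrier G"
    using u B by fastforce
  have eq: "(\<lambda>(i, b). u i [^] l \<otimes> b) ` (I \<times> B) = carrier G"
    using cover into by blast
  have "finite (I \<times> B)" using I B fin finite_subset by blast
  moreover have "card (I \<times> B) = card (carrier G)" using bij by (rule bij_betw_same_card)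
  ultimately have "inj_on (\<lambda>(i, b). u i [^] l \<otimes> b) (I \<times> B)"
    by (intro eq_card_imp_inj_on) (simp_all add: eq)
  then show ?thesis using eq by (simp add: bij_betw_def)
qed

text \<open>Replacing one factor by its \<open>n\<close>-th powers, one prime divisor of \<open>n\<close> at a time. The exponent
  need not be prime to the order of the group: it may kill a whole direct component.\<close>

lemma tiling_power:
  assumes fin: "finite (carrier G)" and n: "coprime n (card I)" "n > 0"
    and u: "u \<in> I \<rightarrow> carrier G" and B: "B \<subseteq> carrier G" and I: "finite I"
    and bij: "bij_betw (\<lambda>(i, b). u i \<otimes> b) (I \<times> B) (carrier G)"
  shows "bij_betw (\<lambda>(i, b). u i [^] n \<otimes> b) (I \<times> B) (carrier G)"
  using n(2,1)
proof (induction n rule: prime_divisors_induct)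
  case zero
  then show ?case by simp
next
  case (unit n)
  have "u i [^] (1::nat) \<otimes> b = u i \<otimes> b" if "i \<in> I" for i b
    using that u by (auto simp: Pi_iff)
  then have "bij_betw (\<lambda>(i, b). u i [^] (1::nat) \<otimes> b) (I \<times> B) (carrier G)"
    using bij by (subst bij_betw_cong[where g = "\<lambda>(i, b). u i \<otimes> b"]) auto
  then show ?case using unit by simp
next
  case (factor l n)
  then have "coprime n (card I)" "n > 0" "\<not> l dvd card I"
    by (auto dest: coprime_common_divisor_nat simp: not_prime_unit)
  with factor have "bij_betw (\<lambda>(i, b). u i [^] n \<otimes> b) (I \<times> B) (carrier G)" by simp
  then have *: "bij_betw (\<lambda>(i, b). (u i [^] n) [^] l \<otimes> b) (I \<times> B) (carrier G)"
    using u by (intro tiling_prime_power[OF fin factor(1) \<open>\<not> l dvd card I\<close> _ B I]) auto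
  have "(u i [^] n) [^] l \<otimes> b = u i [^] (l * n) \<otimes> b" if "i \<in> I" for i b
    using that u by (auto simp: Pi_iff nat_pow_pow mult.commute)
  then show ?case
    using * by (subst bij_betw_cong[where g = "\<lambda>(i, b). (u i [^] n) [^] l \<otimes> b"]) auto
qed

end

definition tiling :: "('a, 'b) monoid_scheme \<Rightarrow> 'a set \<Rightarrow> 'a set \<Rightarrow> bool" where
  "tiling G A B \<longleftrightarrow> A \<subseteq> carrier G \<and> B \<subseteq> carrier G \<and>
     bij_betw (\<lambda>(a, b). a \<otimes>\<^bsub>G\<^esub> b) (A \<times> B) (carrier G)"

lemma (in comm_group) tiling_commute:
  assumes "tiling G A B"
  shows "tiling G B A"
proof -
  have "bij_betw ((\<lambda>(a, b). a \<otimes> b) \<circ> prod.swap) (B \<times> A) (carrier G)"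
    using assms by (intro bij_betw_trans[OF bij_betw_imageI[OF inj_on_subset[OF inj_swap]]])
      (auto simp: tiling_def product_swap)
  moreover have "((\<lambda>(a, b). a \<otimes> b) \<circ> prod.swap) c = (\<lambda>(a, b). a \<otimes> b) c" if "c \<in> B \<times> A" for c
    using assms that by (auto simp: tiling_def intro: m_comm)
  ultimately show ?thesis
    using assms by (subst (asm) bij_betw_cong) (auto simp: tiling_def)
qed

lemma tiling_card: "tiling G A B \<Longrightarrow> card A * card B = card (carrier G)"
  unfolding tiling_def by (metis bij_betw_same_card card_cartesian_product)

lemma (in comm_group) tiling_power_eqD:
  assumes fin: "finite (carrier G)" and til: "tiling G A B" and n: "coprime n (card A)" "n > 0"
    and ab: "a \<in> A" "a' \<in> A" "b \<in> B" "b' \<in> B"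
    and eq: "a [^] n \<otimes> b = a' [^] n \<otimes> b'"
  shows "a = a'" "b = b'"
proof -
  have "finite A" using fin til finite_subset by (auto simp: tiling_def)
  then have "bij_betw (\<lambda>(i, b). i [^] n \<otimes> b) (A \<times> B) (carrier G)"
    using til by (intro tiling_power[OF fin n]) (auto simp: tiling_def)
  then have "inj_on (\<lambda>(i, b). i [^] n \<otimes> b) (A \<times> B)" by (simp add: bij_betw_def)
  from inj_onD[OF this, of "(a, b)" "(a', b')"] eq ab show "a = a'" "b = b'" by auto
qed

section \<open>Coordinates and exponents chosen coordinatewise\<close>

text \<open>The solution is required to be positive because it will serve as an exponent.\<close>

lemma simultaneous_residues:
  fixes p q r :: nat and u v w :: int
  assumes "coprime p q" "coprime p r" "coprime q r" "p > 0" "q > 0" "r > 0"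
  obtains n :: nat where "n > 0"
    "[int n = u] (mod int p)" "[int n = v] (mod int q)" "[int n = w] (mod int r)"
proof -
  obtain m where m: "[m = u] (mod int p)" "[m = v] (mod int q)"
    using binary_chinese_remainder_int[of "int p" "int q" u v] assms by auto
  obtain m' where m': "[m' = m] (mod int p * int q)" "[m' = w] (mod int r)"
    using binary_chinese_remainder_int[of "int p * int q" "int r" m w] assms by auto
  define N where "N = int p * int q * int r"
  define n where "n = nat (m' mod N + N)"
  have "N > 0" using assms by (simp add: N_def)
  then have n: "int n = m' mod N + N" by (simp add: n_def)
  have *: "[int n = m'] (mod d)" if "d dvd N" for d
  proof -
    have "[int n = m'] (mod N)" by (simp add: n cong_def)
    then show ?thesis using that cong_dvd_modulus by blast
  qed
  have m'': "[m' = m] (mod int p)" "[m' = m] (mod int q)"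
    using m'(1) by (auto intro: cong_dvd_modulus)
  show thesis
  proof
    have "int n > 0" using n \<open>N > 0\<close> by (simp add: add_nonneg_pos)
    then show "n > 0" by simp
    show "[int n = u] (mod int p)"
      using *[of "int p"] m''(1) m(1) by (metis N_def cong_trans dvd_mult2 dvd_triv_left)
    show "[int n = v] (mod int q)"
      using *[of "int q"] m''(2) m(2) by (metis N_def cong_trans dvd_mult2 dvd_triv_right)
    show "[int n = w] (mod int r)"
      using *[of "int r"] m'(2) by (metis N_def cong_trans dvd_triv_right)
  qed
qed

lemma linear_congruence_solvable:
  fixes d e :: int
  assumes "prime p" "\<not> int p dvd d"
  obtains u where "[u * d = e] (mod int p)"
proof -
  have "coprime d (int p)"
    using prime_imp_coprime[of "int p" d] assms by (simp add: coprime_commute)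
  then obtain v where "[d * v = 1] (mod int p)" using cong_solve_coprime_int by blast
  then have "[(d * v) * e = 1 * e] (mod int p)" by (rule cong_scalar_right)
  then show thesis by (intro that[of "v * e"]) (simp add: mult_ac)
qed

lemma idx_cong_eq: "i \<in> idx n \<Longrightarrow> j \<in> idx n \<Longrightarrow> [i = j] (mod int n) \<Longrightarrow> i = j"
  by (auto simp: idx_def cong_def)

lemma idx_mod: "i \<in> idx n \<Longrightarrow> i mod int n = i"
  by (simp add: idx_def)

lemma card_idx [simp]: "card (idx n) = n"
  by (simp add: idx_def)

lemma finite_idx [simp]: "finite (idx n)"
  by (simp add: idx_def)

text \<open>The group \<open>\<int>\<^sub>p \<times> \<int>\<^sub>q \<times> \<int>\<^sub>r\<close> seen through three coordinate functions and the map \<open>pt\<close> that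
  assembles an element from integer coordinates. Keeping the coordinates abstract makes the
  symmetry between the three primes available: the same group with its coordinates permuted is
  another instance, so it is enough to study factors whose size is the first prime.\<close>

locale three_coordinates = comm_group G for G (structure) +
  fixes p q r :: nat and x y z :: "'a \<Rightarrow> int" and pt :: "int \<Rightarrow> int \<Rightarrow> int \<Rightarrow> 'a"
  assumes primes: "prime p" "prime q" "prime r"
    and distinct: "p \<noteq> q" "p \<noteq> r" "q \<noteq> r"
    and mult_coords: "\<And>a b. \<lbrakk>a \<in> carrier G; b \<in> carrier G\<rbrakk> \<Longrightarrow> x (a \<otimes> b) = (x a + x b) mod int p"
      "\<And>a b. \<lbrakk>a \<in> carrier G; b \<in> carrier G\<rbrakk> \<Longrightarrow> y (a \<otimes> b) = (y a + y b) mod int q"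
      "\<And>a b. \<lbrakk>a \<in> carrier G; b \<in> carrier G\<rbrakk> \<Longrightarrow> z (a \<otimes> b) = (z a + z b) mod int r"
    and pt_closed [simp]: "pt i j k \<in> carrier G"
    and coords_pt [simp]: "x (pt i j k) = i mod int p" "y (pt i j k) = j mod int q"
      "z (pt i j k) = k mod int r"
    and pt_coords: "a \<in> carrier G \<Longrightarrow> pt (x a) (y a) (z a) = a"
begin

lemma swapped: "three_coordinates G p r q x z y (\<lambda>i j k. pt i k j)"
  by unfold_locales (use primes distinct mult_coords pt_coords in auto)

lemma pos: "p > 0" "q > 0" "r > 0"
  using primes prime_gt_0_nat by auto

lemma coprime_pqr: "coprime p q" "coprime p r" "coprime q r"
  using primes distinct by (auto intro: primes_coprime)

lemma coords_idx:
  assumes "a \<in> carrier G"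
  shows "x a \<in> idx p" "y a \<in> idx q" "z a \<in> idx r"
proof -
  have "x (pt (x a) (y a) (z a)) \<in> idx p" "y (pt (x a) (y a) (z a)) \<in> idx q"
    "z (pt (x a) (y a) (z a)) \<in> idx r"
    using pos by (simp_all add: idx_def)
  then show "x a \<in> idx p" "y a \<in> idx q" "z a \<in> idx r"
    by (simp_all only: pt_coords[OF assms])
qed

lemma coords_eqI:
  assumes "a \<in> carrier G" "b \<in> carrier G"
    and "[x a = x b] (mod int p)" "[y a = y b] (mod int q)" "[z a = z b] (mod int r)"
  shows "a = b"
proof -
  have "x a = x b" "y a = y b" "z a = z b"
    using assms coords_idx by (blast intro: idx_cong_eq)+
  then show ?thesis using pt_coords assms(1,2) by metis
qed

lemma mult_cong:
  assumes "a \<in> carrier G" "b \<in> carrier G"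
  shows "[x (a \<otimes> b) = x a + x b] (mod int p)" "[y (a \<otimes> b) = y a + y b] (mod int q)"
    "[z (a \<otimes> b) = z a + z b] (mod int r)"
  by (simp_all add: mult_coords assms cong_def)

lemma coords_one: "x \<one> = 0" "y \<one> = 0" "z \<one> = 0"
proof -
  have *: "i = 0" if "[i = i + i] (mod int n)" "i \<in> idx n" for i n
  proof -
    have "[i = 0] (mod int n)" using that(1) by (simp add: cong_iff_dvd_diff)
    then show ?thesis using that(2) by (auto simp: idx_def cong_def)
  qed
  show "x \<one> = 0" "y \<one> = 0" "z \<one> = 0"
    using mult_cong[of \<one> \<one>] coords_idx[of \<one>] by (auto intro: *)
qed

lemma pow_cong:
  fixes n :: nat
  assumes "a \<in> carrier G"
  shows "[x (a [^] n) = int n * x a] (mod int p) \<and> [y (a [^] n) = int n * y a] (mod int q) \<and>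
    [z (a [^] n) = int n * z a] (mod int r)"
proof (induction n)
  case (Suc n)
  have *: "[X = int (Suc n) * c] (mod m)" if "[X = Y + c] (mod m)" "[Y = int n * c] (mod m)"
    for X Y c m
    using cong_trans[OF that(1) cong_add[OF that(2) cong_refl]] by (simp add: algebra_simps)
  show ?case using Suc mult_cong[of "a [^] n" a] assms
    by (auto intro!: * simp del: of_nat_Suc)
qed (simp add: coords_one)

lemma carrier_eq: "carrier G = (\<lambda>(i, j, k). pt i j k) ` (idx p \<times> idx q \<times> idx r)"
proof -
  have "a \<in> (\<lambda>(i, j, k). pt i j k) ` (idx p \<times> idx q \<times> idx r)" if "a \<in> carrier G" for a
    using coords_idx[OF that] pt_coords[OF that] by (intro image_eqI[of _ _ "(x a, y a, z a)"]) auto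
  then show ?thesis by auto
qed

lemma finite_carrier [simp]: "finite (carrier G)"
  by (simp add: carrier_eq)

lemma card_carrier: "card (carrier G) = p * q * r"
proof -
  have "inj_on (\<lambda>(i, j, k). pt i j k) (idx p \<times> idx q \<times> idx r)"
  proof (clarsimp simp: inj_on_def)
    fix i j k i' j' k'
    assume *: "pt i j k = pt i' j' k'" "i \<in> idx p" "j \<in> idx q" "k \<in> idx r"
      "i' \<in> idx p" "j' \<in> idx q" "k' \<in> idx r"
    from arg_cong[OF *(1), of x] arg_cong[OF *(1), of y] arg_cong[OF *(1), of z]
    show "i = i' \<and> j = j' \<and> k = k'"
      by (simp add: idx_mod *(2-))
  qed
  then show ?thesis by (simp add: carrier_eq card_image)
qed

text \<open>The tool for everything that follows. The Chinese remainder theorem merges the multipliers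
  \<open>u\<close>, \<open>v\<close>, \<open>w\<close>, chosen separately in the three coordinates, into one exponent \<open>n\<close>, which is prime
  to \<open>card A\<close> by the divisibility hypotheses; the congruences say that
  \<open>a\<^sup>n \<otimes> b = a'\<^sup>n \<otimes> b'\<close>, which the tiling by \<open>n\<close>-th powers forbids unless both pairs agree.\<close>

lemma tiling_congD:
  assumes til: "tiling G A B"
    and ab: "a \<in> A" "a' \<in> A" "b \<in> B" "b' \<in> B"
    and u: "[u * (x a - x a') = x b' - x b] (mod int p)" "p dvd card A \<Longrightarrow> \<not> int p dvd u"
    and v: "[v * (y a - y a') = y b' - y b] (mod int q)" "q dvd card A \<Longrightarrow> \<not> int q dvd v"
    and w: "[w * (z a - z a') = z b' - z b] (mod int r)" "r dvd card A \<Longrightarrow> \<not> int r dvd w"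
  shows "a = a'" "b = b'"
proof -
  obtain n :: nat where n: "n > 0"
    "[int n = u] (mod int p)" "[int n = v] (mod int q)" "[int n = w] (mod int r)"
    using simultaneous_residues coprime_pqr pos by metis
  have c: "a \<in> carrier G" "a' \<in> carrier G" "b \<in> carrier G" "b' \<in> carrier G"
    using til ab by (auto simp: tiling_def)
  have "coprime n (card A)"
  proof (rule ccontr)
    assume "\<not> coprime n (card A)"
    then have "gcd n (card A) \<noteq> 1" using coprime_iff_gcd_eq_1 by blast
    from prime_factor_nat[OF this] obtain l where l: "prime l" "l dvd n" "l dvd card A"
      by auto
    have "l dvd p * q * r"
      using dvd_mult2[OF l(3), of "card B"] tiling_card[OF til] card_carrier by simp
    then have "l dvd p \<or> l dvd q \<or> l dvd r"
      using l(1) by (simp add: prime_dvd_mult_iff)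
    then have "l = p \<or> l = q \<or> l = r"
      using primes_dvd_imp_eq l(1) primes by blast
    then show False
      using l u(2) v(2) w(2) cong_dvd_iff[OF n(2)] cong_dvd_iff[OF n(3)] cong_dvd_iff[OF n(4)]
      by auto
  qed
  have *: "[X = X'] (mod m)"
    if "[X = P + d] (mod m)" "[X' = P' + d'] (mod m)" "[P = int n * c] (mod m)"
      "[P' = int n * c'] (mod m)" "[int n = t] (mod m)" "[t * (c - c') = d' - d] (mod m)"
    for X X' P P' c c' d d' t m
  proof -
    have "[X = int n * c + d] (mod m)"
      using cong_trans[OF that(1) cong_add[OF that(3) cong_refl]] .
    moreover have "[X' = int n * c' + d'] (mod m)"
      using cong_trans[OF that(2) cong_add[OF that(4) cong_refl]] .
    moreover have "[int n * c + d = int n * c' + d'] (mod m)"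
    proof -
      have "[int n * (c - c') = d' - d] (mod m)"
        using cong_trans[OF cong_scalar_right[OF that(5)] that(6)] .
      then show ?thesis by (simp add: cong_iff_dvd_diff algebra_simps)
    qed
    ultimately show ?thesis by (metis cong_sym cong_trans)
  qed
  have "a [^] n \<otimes> b = a' [^] n \<otimes> b'"
  proof (rule coords_eqI)
    note p = pow_cong[of a n, OF c(1)] pow_cong[of a' n, OF c(2)]
    note m = mult_cong[OF nat_pow_closed[OF c(1), of n] c(3)]
    note m' = mult_cong[OF nat_pow_closed[OF c(2), of n] c(4)]
    show "[x (a [^] n \<otimes> b) = x (a' [^] n \<otimes> b')] (mod int p)"
      using * [OF m(1) m'(1) _ _ n(2) u(1)] p by blast
    show "[y (a [^] n \<otimes> b) = y (a' [^] n \<otimes> b')] (mod int q)"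
      using * [OF m(2) m'(2) _ _ n(3) v(1)] p by blast
    show "[z (a [^] n \<otimes> b) = z (a' [^] n \<otimes> b')] (mod int r)"
      using * [OF m(3) m'(3) _ _ n(4) w(1)] p by blast
  qed (use c in auto)
  then show "a = a'" "b = b'"
    using tiling_power_eqD[OF finite_carrier til \<open>coprime n (card A)\<close> n(1) ab] by auto
qed

end

section \<open>Tilings with a factor of prime size\<close>

context three_coordinates
begin

text \<open>Multipliers 1, 0, 0: the powers of \<open>A\<close> are its projections to the first coordinate.\<close>

lemma tiling_inj_first:
  assumes til: "tiling G A B" and card: "card A = p" and one: "\<one> \<in> B"
  shows "inj_on x A"
proof (rule inj_onI)
  fix a a' assume "a \<in> A" "a' \<in> A" "x a = x a'"
  moreover have "\<not> q dvd p" "\<not> r dvd p" "\<not> int p dvd 1"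
    using primes distinct primes_dvd_imp_eq prime_gt_1_nat[of p] by auto
  ultimately show "a = a'"
    using tiling_congD(1)[OF til _ _ one one, of a a' 1 0 0] card by simp
qed

text \<open>The same argument with the two factors exchanged and multipliers 0, 1, 1, which are prime to
  \<open>card B = q * r\<close>.\<close>

lemma tiling_inj_rest:
  assumes til: "tiling G A B" and card: "card A = p" and one: "\<one> \<in> A"
  shows "inj_on (\<lambda>b. (y b, z b)) B"
proof (rule inj_onI)
  fix b b' assume b: "b \<in> B" "b' \<in> B" "(y b, z b) = (y b', z b')"
  have "p * card B = p * (q * r)"
    using tiling_card[OF til] card card_carrier by (simp add: mult.assoc)
  then have "card B = q * r" using pos by simp
  then have "\<not> p dvd card B"
    using primes distinct primes_dvd_imp_eq by (auto simp: prime_dvd_mult_iff)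
  moreover have "\<not> int q dvd 1" "\<not> int r dvd 1"
    using primes prime_gt_1_nat by auto
  ultimately show "b = b'"
    using tiling_congD(1)[OF tiling_commute[OF til] b(1,2) one one, of 0 1 1] b(3) by simp
qed

text \<open>If \<open>A\<close> varied in the second coordinate while the first coordinate of \<open>B\<close> depended on the
  second, multipliers could be solved for that carry a nonzero difference in \<open>A\<close> to a difference in
  \<open>B\<close>. The multiplier in the first coordinate comes out nonzero, as it must to be prime to
  \<open>card A = p\<close>; the other two are unrestricted.\<close>

lemma tiling_dichotomy:
  assumes til: "tiling G A B" and card: "card A = p" and one: "\<one> \<in> B"
    and a: "a \<in> A" "a' \<in> A" "y a \<noteq> y a'"
    and b: "b \<in> B" "b' \<in> B" "z b = z b'"
  shows "x b = x b'"
proof (rule ccontr)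
  assume xb: "x b \<noteq> x b'"
  have c: "a \<in> carrier G" "a' \<in> carrier G" "b \<in> carrier G" "b' \<in> carrier G"
    using til a b by (auto simp: tiling_def)
  have ndvd: "\<not> int n dvd i - j" if "i \<in> idx n" "j \<in> idx n" "i \<noteq> j" for n i j
    using that idx_cong_eq cong_iff_dvd_diff by blast
  have "x a \<noteq> x a'"
    using inj_onD[OF tiling_inj_first[OF til card one]] a by blast
  then have "\<not> int p dvd x a - x a'" using ndvd c coords_idx by blast
  then obtain u where u: "[u * (x a - x a') = x b' - x b] (mod int p)"
    using linear_congruence_solvable primes by blast
  have "\<not> int q dvd y a - y a'" using ndvd c coords_idx a(3) by blast
  then obtain v where v: "[v * (y a - y a') = y b' - y b] (mod int q)"
    using linear_congruence_solvable primes by blast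
  have "\<not> int p dvd x b' - x b" using ndvd c coords_idx xb by metis
  then have "\<not> int p dvd u"
    using u by (metis cong_dvd_iff dvd_mult2)
  moreover have "\<not> q dvd card A" "\<not> r dvd card A"
    using primes distinct primes_dvd_imp_eq card by auto
  ultimately have "a = a'"
    using tiling_congD(1)[OF til a(1,2) b(1,2) u _ v, of 0] b(3) by simp
  then show False using a(3) by simp
qed

text \<open>By the injectivity just shown, a factor of size \<open>p\<close> is a graph over the first coordinate and its
  complement is a graph over the other two.\<close>

definition column :: "(int \<Rightarrow> int) \<Rightarrow> (int \<Rightarrow> int) \<Rightarrow> 'a set" where
  "column \<alpha> \<beta> = {pt i (\<alpha> i) (\<beta> i) | i. i \<in> idx p}"

definition sheet :: "(int \<Rightarrow> int \<Rightarrow> int) \<Rightarrow> 'a set" where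
  "sheet l = {pt (l j k) j k | j k. j \<in> idx q \<and> k \<in> idx r}"

lemma column_cong:
  assumes "\<And>i. i \<in> idx p \<Longrightarrow> \<alpha> i = \<alpha>' i" "\<And>i. i \<in> idx p \<Longrightarrow> \<beta> i = \<beta>' i"
  shows "column \<alpha> \<beta> = column \<alpha>' \<beta>'"
  unfolding column_def using assms by (intro Collect_cong ex_cong1) auto

lemma sheet_cong:
  assumes "\<And>j k. j \<in> idx q \<Longrightarrow> k \<in> idx r \<Longrightarrow> l j k = l' j k"
  shows "sheet l = sheet l'"
  unfolding sheet_def using assms by (intro Collect_cong ex_cong1) auto

text \<open>The functions are read off from the factors by inverting the coordinate projections. Their
  values at 0 are those of the identity element, and comparing each element of \<open>A\<close> with the
  identity turns \<open>tiling_dichotomy\<close>, in both orders of the last two coordinates, into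
  the two alternatives.\<close>

lemma tiling_imp_graphs:
  assumes til: "tiling G A B" and card: "card A = p" and one: "\<one> \<in> A" "\<one> \<in> B"
  obtains \<alpha> \<beta> l where "\<alpha> 0 = 0" "\<beta> 0 = 0" "l 0 0 = 0" "A = column \<alpha> \<beta>" "B = sheet l"
    "(\<forall>i\<in>idx p. \<alpha> i = 0) \<or> (\<forall>j\<in>idx q. \<forall>j'\<in>idx q. \<forall>k\<in>idx r. l j k = l j' k)"
    "(\<forall>i\<in>idx p. \<beta> i = 0) \<or> (\<forall>j\<in>idx q. \<forall>k\<in>idx r. \<forall>k'\<in>idx r. l j k = l j k')"
proof -
  have AB: "A \<subseteq> carrier G" "B \<subseteq> carrier G" using til by (auto simp: tiling_def)
  have injA: "inj_on x A" and injB: "inj_on (\<lambda>b. (y b, z b)) B"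
    using tiling_inj_first tiling_inj_rest til card one by auto
  have "x ` A = idx p"
    using AB coords_idx card_image[OF injA] card by (intro card_subset_eq) auto
  then have bijA: "bij_betw x A (idx p)" using injA by (simp add: bij_betw_def)
  have "p * card B = p * (q * r)"
    using tiling_card[OF til] card card_carrier by (simp add: mult.assoc)
  then have "card B = q * r" using pos by simp
  then have "(\<lambda>b. (y b, z b)) ` B = idx q \<times> idx r"
    using AB coords_idx card_image[OF injB] by (intro card_subset_eq) auto
  then have bijB: "bij_betw (\<lambda>b. (y b, z b)) B (idx q \<times> idx r)"
    using injB by (simp add: bij_betw_def)
  define s where "s = inv_into A x"
  define t where "t = (\<lambda>j k. inv_into B (\<lambda>b. (y b, z b)) (j, k))"
  have s: "s i \<in> A" "x (s i) = i" if "i \<in> idx p" for i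
    using that bij_betw_inv_into_right[OF bijA] bij_betw_apply[OF bij_betw_inv_into[OF bijA]]
    by (auto simp: s_def)
  have s': "s (x a) = a" if "a \<in> A" for a
    using that bij_betw_inv_into_left[OF bijA] by (simp add: s_def)
  have t: "t j k \<in> B" "y (t j k) = j" "z (t j k) = k" if "j \<in> idx q" "k \<in> idx r" for j k
    using that bij_betw_inv_into_right[OF bijB, of "(j, k)"]
      bij_betw_apply[OF bij_betw_inv_into[OF bijB], of "(j, k)"]
    by (auto simp: t_def)
  have t': "t (y b) (z b) = b" if "b \<in> B" for b
    using that bij_betw_inv_into_left[OF bijB, of b] by (simp add: t_def)
  define \<alpha> \<beta> l where "\<alpha> = (\<lambda>i. y (s i))" and "\<beta> = (\<lambda>i. z (s i))" and "l = (\<lambda>j k. x (t j k))"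
  have s0: "s 0 = \<one>" and t0: "t 0 0 = \<one>"
    using s'[OF one(1)] t'[OF one(2)] by (simp_all add: coords_one)
  have pt_s: "pt i (\<alpha> i) (\<beta> i) = s i" if "i \<in> idx p" for i
    using s[OF that] pt_coords[of "s i"] AB by (auto simp: \<alpha>_def \<beta>_def)
  have pt_t: "pt (l j k) j k = t j k" if "j \<in> idx q" "k \<in> idx r" for j k
    using t[OF that] pt_coords[of "t j k"] AB by (auto simp: l_def)
  have A: "A = column \<alpha> \<beta>"
  proof (intro equalityI subsetI)
    fix a assume "a \<in> A"
    then have xa: "x a \<in> idx p" using AB coords_idx by auto
    then have "a = pt (x a) (\<alpha> (x a)) (\<beta> (x a))" using pt_s s'[OF \<open>a \<in> A\<close>] by simp
    then show "a \<in> column \<alpha> \<beta>" unfolding column_def using xa by blast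
  qed (auto simp: column_def pt_s s)
  have B: "B = sheet l"
  proof (intro equalityI subsetI)
    fix b assume "b \<in> B"
    then have yz: "y b \<in> idx q" "z b \<in> idx r" using AB coords_idx by auto
    then have "b = pt (l (y b) (z b)) (y b) (z b)" using pt_t t'[OF \<open>b \<in> B\<close>] by simp
    then show "b \<in> sheet l" unfolding sheet_def using yz by blast
  qed (auto simp: sheet_def pt_t t)
  have 1: "l j k = l j' k"
    if "i \<in> idx p" "\<alpha> i \<noteq> 0" "j \<in> idx q" "j' \<in> idx q" "k \<in> idx r" for i j j' k
    using tiling_dichotomy[OF til card one(2) s(1)[OF that(1)] one(1), of "t j k" "t j' k"] that t
    by (simp add: \<alpha>_def l_def coords_one)
  have 2: "l j k = l j k'"
    if "i \<in> idx p" "\<beta> i \<noteq> 0" "j \<in> idx q" "k \<in> idx r" "k' \<in> idx r" for i j k k'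
    using three_coordinates.tiling_dichotomy[OF swapped til card one(2) s(1)[OF that(1)] one(1),
        of "t j k" "t j k'"] that t
    by (simp add: \<beta>_def l_def coords_one)
  show thesis
  proof (rule that[OF _ _ _ A B])
    show "\<alpha> 0 = 0" "\<beta> 0 = 0" "l 0 0 = 0"
      by (simp_all add: \<alpha>_def \<beta>_def l_def s0 t0 coords_one)
  qed (use 1 2 in blast)+
qed

text \<open>The two factors have \<open>p\<close> and \<open>q * r\<close> parameters, so uniqueness of representations is enough.
  If two products agree, the alternatives force the values of \<open>l\<close> to agree, coordinate by
  coordinate; then the first parameters agree, and therefore all of them.\<close>

lemma graphs_imp_tiling:
  assumes l1: "(\<forall>i\<in>idx p. \<alpha> i = 0) \<or> (\<forall>j\<in>idx q. \<forall>j'\<in>idx q. \<forall>k\<in>idx r. l j k = l j' k)"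
    and l2: "(\<forall>i\<in>idx p. \<beta> i = 0) \<or> (\<forall>j\<in>idx q. \<forall>k\<in>idx r. \<forall>k'\<in>idx r. l j k = l j k')"
  shows "tiling G (column \<alpha> \<beta>) (sheet l)" "card (column \<alpha> \<beta>) = p"
proof -
  let ?I = "idx p \<times> idx q \<times> idx r"
  let ?m = "\<lambda>(a, b). a \<otimes> b"
  define g where "g = (\<lambda>(i, j, k). (pt i (\<alpha> i) (\<beta> i), pt (l j k) j k))"
  have inj: "inj_on (?m \<circ> g) ?I"
  proof (rule inj_onI)
    fix c c' assume c: "c \<in> ?I" "c' \<in> ?I" "(?m \<circ> g) c = (?m \<circ> g) c'"
    obtain i j k i' j' k' where ijk: "c = (i, j, k)" "c' = (i', j', k')" by (metis prod_cases3)
    have mem: "i \<in> idx p" "j \<in> idx q" "k \<in> idx r" "i' \<in> idx p" "j' \<in> idx q" "k' \<in> idx r"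
      using c ijk by auto
    have eq: "pt i (\<alpha> i) (\<beta> i) \<otimes> pt (l j k) j k = pt i' (\<alpha> i') (\<beta> i') \<otimes> pt (l j' k') j' k'"
      using c(3) by (simp add: ijk g_def)
    have X: "[i + l j k = i' + l j' k'] (mod int p)"
      using arg_cong[OF eq, of x] by (simp add: mult_coords cong_def mod_add_eq)
    have Y: "[\<alpha> i + j = \<alpha> i' + j'] (mod int q)"
      using arg_cong[OF eq, of y] by (simp add: mult_coords cong_def mod_add_eq)
    have Z: "[\<beta> i + k = \<beta> i' + k'] (mod int r)"
      using arg_cong[OF eq, of z] by (simp add: mult_coords cong_def mod_add_eq)
    have J: "j = j'" if "\<alpha> i = \<alpha> i'"
      using idx_cong_eq[OF mem(2,5)] Y that by (simp add: cong_add_lcancel)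
    have K: "k = k'" if "\<beta> i = \<beta> i'"
      using idx_cong_eq[OF mem(3,6)] Z that by (simp add: cong_add_lcancel)
    \<comment> \<open>If the first alternative does not make \<open>l\<close> independent of its first argument, then \<open>\<alpha>\<close>
      vanishes and \<open>Y\<close> gives \<open>j = j'\<close>; likewise for the second argument.\<close>
    have "l j k = l j' k" using l1 J mem by metis
    moreover have "l j' k = l j' k'" using l2 K mem by metis
    ultimately have "i = i'"
      using idx_cong_eq[OF mem(1,4)] X by (simp add: cong_add_rcancel)
    then show "c = c'" using J K ijk by simp
  qed
  have into: "(?m \<circ> g) ` ?I \<subseteq> carrier G" by (auto simp: g_def)
  have "card ((?m \<circ> g) ` ?I) = card (carrier G)"
    by (simp add: card_image[OF inj] card_carrier del: comp_apply)
  then have onto: "(?m \<circ> g) ` ?I = carrier G"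
    using into by (intro card_subset_eq) auto
  have AB: "column \<alpha> \<beta> \<times> sheet l = g ` ?I"
    by (auto simp: column_def sheet_def g_def image_iff) blast+
  have "inj_on ?m (g ` ?I)" using inj by (rule inj_on_imageI)
  moreover have "?m ` g ` ?I = carrier G" using onto by (simp only: image_comp)
  ultimately show "tiling G (column \<alpha> \<beta>) (sheet l)"
    unfolding tiling_def AB bij_betw_def by (auto simp: column_def sheet_def)
  have "column \<alpha> \<beta> = (\<lambda>i. pt i (\<alpha> i) (\<beta> i)) ` idx p" by (auto simp: column_def)
  moreover have "inj_on (\<lambda>i. pt i (\<alpha> i) (\<beta> i)) (idx p)"
  proof (rule inj_onI)
    fix i i' assume *: "i \<in> idx p" "i' \<in> idx p" "pt i (\<alpha> i) (\<beta> i) = pt i' (\<alpha> i') (\<beta> i')"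
    from arg_cong[OF *(3), of x] show "i = i'" by (simp add: idx_mod *(1,2))
  qed
  ultimately show "card (column \<alpha> \<beta>) = p" by (simp add: card_image)
qed

text \<open>Each of the two alternatives offers two choices, which gives the four shapes.\<close>

theorem tiling_prime_card_iff:
  assumes one: "\<one> \<in> A" "\<one> \<in> B"
  shows "tiling G A B \<and> card A = p \<longleftrightarrow>
      (\<exists>\<alpha> \<beta>. \<alpha> 0 = 0 \<and> \<beta> 0 = 0 \<and> A = {pt i (\<alpha> i) (\<beta> i) | i. i \<in> idx p} \<and>
         B = {pt 0 j k | j k. j \<in> idx q \<and> k \<in> idx r}) \<or>
      (\<exists>l \<beta>. l 0 = 0 \<and> \<beta> 0 = 0 \<and> B = {pt (l j) j k | j k. j \<in> idx q \<and> k \<in> idx r} \<and>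
         A = {pt i 0 (\<beta> i) | i. i \<in> idx p}) \<or>
      (\<exists>l \<alpha>. l 0 = 0 \<and> \<alpha> 0 = 0 \<and> B = {pt (l k) j k | k j. k \<in> idx r \<and> j \<in> idx q} \<and>
         A = {pt i (\<alpha> i) 0 | i. i \<in> idx p}) \<or>
      (\<exists>l. l 0 0 = 0 \<and> B = {pt (l j k) j k | j k. j \<in> idx q \<and> k \<in> idx r} \<and>
         A = {pt i 0 0 | i. i \<in> idx p})" (is "?L \<longleftrightarrow> ?R")
proof
  assume ?L
  have zero: "0 \<in> idx q" "0 \<in> idx r" using pos by (auto simp: idx_def)
  obtain \<alpha> \<beta> l where ab: "\<alpha> 0 = 0" "\<beta> 0 = 0" "l 0 0 = 0" and AB: "A = column \<alpha> \<beta>" "B = sheet l"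
    and 1: "(\<forall>i\<in>idx p. \<alpha> i = 0) \<or> (\<forall>j\<in>idx q. \<forall>j'\<in>idx q. \<forall>k\<in>idx r. l j k = l j' k)"
    and 2: "(\<forall>i\<in>idx p. \<beta> i = 0) \<or> (\<forall>j\<in>idx q. \<forall>k\<in>idx r. \<forall>k'\<in>idx r. l j k = l j k')"
    by (rule tiling_imp_graphs[OF conjunct1[OF \<open>?L\<close>] conjunct2[OF \<open>?L\<close>] one])
  from 1 2 consider
      (const) "\<And>j k. j \<in> idx q \<Longrightarrow> k \<in> idx r \<Longrightarrow> l j k = 0"
    | (second) "\<And>i. i \<in> idx p \<Longrightarrow> \<alpha> i = 0"
        "\<And>j k. j \<in> idx q \<Longrightarrow> k \<in> idx r \<Longrightarrow> l j k = l j 0"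
    | (third) "\<And>i. i \<in> idx p \<Longrightarrow> \<beta> i = 0"
        "\<And>j k. j \<in> idx q \<Longrightarrow> k \<in> idx r \<Longrightarrow> l j k = l 0 k"
    | (both) "\<And>i. i \<in> idx p \<Longrightarrow> \<alpha> i = 0" "\<And>i. i \<in> idx p \<Longrightarrow> \<beta> i = 0"
  proof (elim disjE)
    assume *: "\<forall>j\<in>idx q. \<forall>j'\<in>idx q. \<forall>k\<in>idx r. l j k = l j' k"
      "\<forall>j\<in>idx q. \<forall>k\<in>idx r. \<forall>k'\<in>idx r. l j k = l j k'"
    have "l j k = 0" if "j \<in> idx q" "k \<in> idx r" for j k
    proof -
      have "l j k = l 0 k" using *(1) that zero by blast
      also have "\<dots> = l 0 0" using *(2) that zero by blast
      finally show ?thesis using ab(3) by simp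
    qed
    then show ?thesis by (rule const)
  qed (use zero in blast)+
  then show ?R
  proof cases
    case const
    then have "B = sheet (\<lambda>j k. 0)" unfolding AB by (rule sheet_cong)
    then show ?thesis
      using ab AB(1) unfolding column_def sheet_def by (intro disjI1 exI[of _ \<alpha>] exI[of _ \<beta>]) simp
  next
    case second
    have B: "B = sheet (\<lambda>j k. l j 0)" unfolding AB by (rule sheet_cong) (rule second(2))
    have A: "A = column (\<lambda>i. 0) \<beta>" unfolding AB by (rule column_cong) (simp_all add: second(1))
    show ?thesis
      using ab A B unfolding column_def sheet_def
      by (intro disjI2[OF disjI1] exI[of _ "\<lambda>j. l j 0"] exI[of _ \<beta>]) simp
  next
    case third
    have "B = sheet (\<lambda>j k. l 0 k)" unfolding AB by (rule sheet_cong) (rule third(2))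
    then have B: "B = {pt (l 0 k) j k | k j. k \<in> idx r \<and> j \<in> idx q}"
      unfolding sheet_def by blast
    have A: "A = column \<alpha> (\<lambda>i. 0)" unfolding AB by (rule column_cong) (simp_all add: third(1))
    show ?thesis
      using ab A B unfolding column_def
      by (intro disjI2[OF disjI2[OF disjI1]] exI[of _ "l 0"] exI[of _ \<alpha>]) simp
  next
    case both
    then have "A = column (\<lambda>i. 0) (\<lambda>i. 0)" unfolding AB by (rule column_cong)
    then show ?thesis
      using ab AB(2) unfolding column_def sheet_def
      by (intro disjI2[OF disjI2[OF disjI2]] exI[of _ l]) simp
  qed
next
  have suff: "tiling G A B \<and> card A = p"
    if "A = column \<alpha> \<beta>" "B = sheet l"
      "(\<forall>i\<in>idx p. \<alpha> i = 0) \<or> (\<forall>j\<in>idx q. \<forall>j'\<in>idx q. \<forall>k\<in>idx r. l j k = l j' k)"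
      "(\<forall>i\<in>idx p. \<beta> i = 0) \<or> (\<forall>j\<in>idx q. \<forall>k\<in>idx r. \<forall>k'\<in>idx r. l j k = l j k')" for \<alpha> \<beta> l
    using graphs_imp_tiling[OF that(3,4)] that(1,2) by simp
  assume ?R
  then show ?L
  proof (elim disjE exE conjE)
    fix \<alpha> \<beta>
    assume "A = {pt i (\<alpha> i) (\<beta> i) | i. i \<in> idx p}"
      "B = {pt 0 j k | j k. j \<in> idx q \<and> k \<in> idx r}"
    then show ?L by (intro suff[of \<alpha> \<beta> "\<lambda>j k. 0"]) (auto simp: column_def sheet_def)
  next
    fix l \<beta>
    assume "A = {pt i 0 (\<beta> i) | i. i \<in> idx p}"
      "B = {pt (l j) j k | j k. j \<in> idx q \<and> k \<in> idx r}"
    then show ?L by (intro suff[of "\<lambda>i. 0" \<beta> "\<lambda>j k. l j"]) (auto simp: column_def sheet_def)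
  next
    fix l \<alpha>
    assume "A = {pt i (\<alpha> i) 0 | i. i \<in> idx p}"
      "B = {pt (l k) j k | k j. k \<in> idx r \<and> j \<in> idx q}"
    then show ?L by (intro suff[of \<alpha> "\<lambda>i. 0" "\<lambda>j k. l k"]) (auto simp: column_def sheet_def)
  next
    fix l
    assume "A = {pt i 0 0 | i. i \<in> idx p}"
      "B = {pt (l j k) j k | j k. j \<in> idx q \<and> k \<in> idx r}"
    then show ?L by (intro suff[of "\<lambda>i. 0" "\<lambda>i. 0" l]) (auto simp: column_def sheet_def)
  qed
qed

end

section \<open>Perfect codes as tilings with a factor of prime size\<close>

lemma factors_of_two_primes:
  fixes d e q r :: nat
  assumes "prime q" "prime r" "d * e = q * r"
  shows "d = 1 \<or> e = 1 \<or> e = q \<or> e = r"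
proof -
  have "q dvd d * e" using assms(3) by simp
  then consider d' where "d = q * d'" | e' where "e = q * e'"
    using assms(1) prime_dvd_mult_iff[of q d e] by blast
  then show ?thesis
  proof cases
    case 1
    then have "d' * e = r" using assms prime_gt_0_nat[of q] by (simp add: mult.assoc)
    then show ?thesis using prime_product[of d' e] assms(2) by auto
  next
    case 2
    then have "d * e' = r" using assms prime_gt_0_nat[of q] by (simp add: mult.left_commute)
    then show ?thesis using prime_product[of d e'] assms(2) 2 by auto
  qed
qed

lemma factor_of_three_primes:
  fixes d e p q r :: nat
  assumes "prime p" "prime q" "prime r" "d * e = p * q * r" "d \<noteq> 1" "e \<noteq> 1"
  shows "d \<in> {p, q, r} \<or> e \<in> {p, q, r}"
proof -
  have main: "d = p \<or> e = q \<or> e = r"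
    if "p dvd d" "d * e = p * (q * r)" "e \<noteq> 1" for d e
  proof -
    obtain d' where d': "d = p * d'" using \<open>p dvd d\<close> by blast
    then have "d' * e = q * r" using that assms(1) prime_gt_0_nat[of p] by (simp add: mult.assoc)
    then show ?thesis using factors_of_two_primes[of q r d' e] assms(2,3) that(3) d' by auto
  qed
  have eq: "d * e = p * (q * r)" "e * d = p * (q * r)" using assms(4) by (simp_all add: ac_simps)
  have "p dvd d * e" using eq by simp
  then have "p dvd d \<or> p dvd e" using assms(1) by (simp add: prime_dvd_mult_iff)
  then show ?thesis using main[of d e] main[of e d] eq assms(5,6) by auto
qed

text \<open>The closed neighbourhood of \<open>c\<close> is the translate of \<open>S \<union> {\<one>}\<close> by \<open>c\<close>.\<close>

lemma (in comm_group) perfect_code_iff_tiling: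
  assumes S: "S \<subseteq> carrier G" and C: "C \<subseteq> carrier G"
  shows "perfect_code (Cay G S) C \<longleftrightarrow> tiling G (S \<union> {\<one>}) C"
proof -
  let ?N = "closed_out_nbhd (Cay G S)"
  let ?S = "S \<union> {\<one>}"
  let ?m = "\<lambda>(s, c). s \<otimes> c"
  have S0: "?S \<subseteq> carrier G" using S by auto
  have N: "?N c = (\<lambda>s. s \<otimes> c) ` ?S" if c: "c \<in> C" for c
  proof -
    have cc: "c \<in> carrier G" using c C by auto
    have "{v. c \<rightarrow>\<^bsub>Cay G S\<^esub> v} = {v \<in> carrier G. v \<otimes> inv c \<in> S}"
      using cc by (auto simp: Cay_def arcs_ends_def arc_to_ends_def image_iff)
    also have "\<dots> = (\<lambda>s. s \<otimes> c) ` S"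
    proof (intro equalityI subsetI)
      fix v assume v: "v \<in> {v \<in> carrier G. v \<otimes> inv c \<in> S}"
      then have "v = (v \<otimes> inv c) \<otimes> c" using cc by (simp add: m_assoc)
      then show "v \<in> (\<lambda>s. s \<otimes> c) ` S" using v by blast
    qed (use S cc in \<open>auto simp: m_assoc\<close>)
    finally show ?thesis using cc by (simp add: closed_out_nbhd_def insert_commute)
  qed
  have "(\<Union>c\<in>C. ?N c) = ?m ` (?S \<times> C)"
    unfolding image_def[of ?m] using N by (auto simp: image_iff)
  moreover have "disjoint_family_on ?N C \<longleftrightarrow> inj_on ?m (?S \<times> C)"
  proof
    assume dis: "disjoint_family_on ?N C"
    show "inj_on ?m (?S \<times> C)"
    proof (rule inj_onI)
      fix a a' assume a: "a \<in> ?S \<times> C" "a' \<in> ?S \<times> C" "?m a = ?m a'"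
      obtain s c s' c' where [simp]: "a = (s, c)" "a' = (s', c')" by (metis surj_pair)
      have mem: "s \<in> ?S" "c \<in> C" "s' \<in> ?S" "c' \<in> C" using a by auto
      have "s \<otimes> c \<in> ?N c" unfolding N[OF mem(2)] using mem(1) by (rule imageI)
      moreover have "s' \<otimes> c' \<in> ?N c'" unfolding N[OF mem(4)] using mem(3) by (rule imageI)
      moreover have "s \<otimes> c = s' \<otimes> c'" using a(3) by simp
      ultimately have "?N c \<inter> ?N c' \<noteq> {}" by (metis IntI empty_iff)
      then have "c = c'" using disjoint_family_onD[OF dis mem(2,4)] by blast
      moreover have "s \<in> carrier G" "s' \<in> carrier G" "c \<in> carrier G" using a S0 C by auto
      ultimately show "a = a'" using a(3) by simp
    qed
  next
    assume inj: "inj_on ?m (?S \<times> C)"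
    show "disjoint_family_on ?N C"
      unfolding disjoint_family_on_def
    proof (intro ballI impI)
      fix c c' assume c: "c \<in> C" "c' \<in> C" "c \<noteq> c'"
      have False if v: "v \<in> ?N c" "v \<in> ?N c'" for v
      proof -
        obtain s s' where "s \<in> ?S" "s' \<in> ?S" "v = s \<otimes> c" "v = s' \<otimes> c'"
          using v unfolding N[OF c(1)] N[OF c(2)] by blast
        then show False using inj_onD[OF inj, of "(s, c)" "(s', c')"] c by auto
      qed
      then show "?N c \<inter> ?N c' = {}" by blast
    qed
  qed
  ultimately show ?thesis
    using S0 C by (auto simp: perfect_code_def tiling_def bij_betw_def Cay_def)
qed

context three_coordinates
begin

lemma transposed: "three_coordinates G q p r y x z (\<lambda>j i k. pt i j k)"
  by unfold_locales (use primes distinct mult_coords pt_coords in auto)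

lemma rotated: "three_coordinates G r p q z x y (\<lambda>k i j. pt i j k)"
  by (rule three_coordinates.transposed[OF swapped])

lemma generating_set_coord:
  assumes "generate G S = carrier G" "S \<subseteq> carrier G"
  shows "\<exists>s\<in>S. x s \<noteq> 0"
proof (rule ccontr)
  assume "\<not> ?thesis"
  then have S: "S \<subseteq> {a \<in> carrier G. x a = 0}" using assms by auto
  have inv: "x (inv a) = 0" if "a \<in> carrier G" "x a = 0" for a
  proof -
    have "[x \<one> = x a + x (inv a)] (mod int p)"
      using mult_cong(1)[of a "inv a"] that by simp
    then show ?thesis
      using idx_cong_eq[OF coords_idx(1)[of "inv a"], of 0] that pos
      by (simp add: coords_one cong_sym idx_def)
  qed
  have "subgroup {a \<in> carrier G. x a = 0} G"
    by (rule subgroupI) (use inv coords_one in \<open>auto simp: mult_coords\<close>)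
  from generate_subgroup_incl[OF S this] have "pt 1 0 0 \<in> {a \<in> carrier G. x a = 0}"
    unfolding assms(1) using pt_closed by (rule subsetD)
  then have "x (pt 1 0 0) = 0" by simp
  then show False using prime_gt_1_nat[OF primes(1)] by simp
qed

lemma tiling_factor_cards:
  assumes til: "tiling G A B" and one: "\<one> \<in> A"
    and ne: "A \<noteq> {\<one>}" "A \<noteq> carrier G"
  shows "card A \<in> {p, q, r} \<or> card B \<in> {p, q, r}"
proof (rule factor_of_three_primes[OF primes])
  have A: "A \<subseteq> carrier G" using til by (simp add: tiling_def)
  show c: "card A * card B = p * q * r" using tiling_card[OF til] card_carrier by simp
  show "card A \<noteq> 1" using ne(1) one by (auto simp: card_1_singleton_iff)
  show "card B \<noteq> 1"
    using card_subset_eq[OF finite_carrier A] ne(2) c card_carrier by auto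
qed

text \<open>Three of the four shapes of a factor of size \<open>p\<close> lie in a coordinate plane, which a generating set
  does not.\<close>

theorem tiling_by_prime_generating_set_iff:
  assumes one: "\<one> \<in> S0" "\<one> \<in> C" and gen: "\<exists>s\<in>S0. y s \<noteq> 0" "\<exists>s\<in>S0. z s \<noteq> 0"
  shows "tiling G S0 C \<and> card S0 = p \<longleftrightarrow>
      (\<exists>\<alpha> \<beta>. \<alpha> 0 = 0 \<and> \<beta> 0 = 0 \<and> S0 = {pt i (\<alpha> i) (\<beta> i) | i. i \<in> idx p} \<and>
         C = {pt 0 j k | j k. j \<in> idx q \<and> k \<in> idx r})"
proof -
  have "S0 \<noteq> {pt i 0 (\<beta> i) | i. i \<in> idx p}" for \<beta> using gen(1) by auto
  moreover have "S0 \<noteq> {pt i (\<alpha> i) 0 | i. i \<in> idx p}" for \<alpha> using gen(2) by auto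
  moreover have "S0 \<noteq> {pt i 0 0 | i. i \<in> idx p}" using gen(1) by auto
  ultimately show ?thesis unfolding tiling_prime_card_iff[OF one] by simp
qed

text \<open>Here the generating set is the complement of a factor of size \<open>p\<close>, and only one of the four
  shapes of such a complement lies in a coordinate plane.\<close>

theorem tiling_by_prime_code_iff:
  assumes one: "\<one> \<in> S0" "\<one> \<in> C" and gen: "\<exists>s\<in>S0. x s \<noteq> 0"
  shows "tiling G S0 C \<and> card C = p \<longleftrightarrow>
      (\<exists>\<alpha> l. \<alpha> 0 = 0 \<and> l 0 = 0 \<and> S0 = {pt (\<alpha> j) j k | j k. j \<in> idx q \<and> k \<in> idx r} \<and>
         C = {pt i 0 (l i) | i. i \<in> idx p}) \<or>
      (\<exists>\<alpha> l. \<alpha> 0 = 0 \<and> l 0 = 0 \<and> S0 = {pt (\<alpha> k) j k | k j. k \<in> idx r \<and> j \<in> idx q} \<and>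
         C = {pt i (l i) 0 | i. i \<in> idx p}) \<or>
      (\<exists>\<alpha>. \<alpha> 0 0 = 0 \<and> S0 = {pt (\<alpha> j k) j k | j k. j \<in> idx q \<and> k \<in> idx r} \<and>
         C = {pt i 0 0 | i. i \<in> idx p})"
proof -
  have "S0 \<noteq> {pt 0 j k | j k. j \<in> idx q \<and> k \<in> idx r}" using gen by auto
  moreover have "tiling G S0 C \<longleftrightarrow> tiling G C S0" using tiling_commute by blast
  ultimately show ?thesis using tiling_prime_card_iff[OF one(2,1)] by simp
qed

end

lemma three_coordinates_Z3:
  assumes "prime p" "prime q" "prime r" "p \<noteq> q" "p \<noteq> r" "q \<noteq> r"
  shows "three_coordinates (Z3 p q r) p q r fst (\<lambda>a. fst (snd a)) (\<lambda>a. snd (snd a))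
           (\<lambda>i j k. red3 p q r (i, j, k))"
proof -
  have pos: "p > 0" "q > 0" "r > 0" using assms prime_gt_0_nat by auto
  have "group (Z3 p q r)"
    unfolding Z3_def by (intro DirProd_group group_integer_mod_group)
  then interpret comm_group "Z3 p q r"
    by (rule group.group_comm_groupI) (auto simp: Z3_def add.commute)
  show ?thesis
    by unfold_locales
      (use assms pos in \<open>auto simp: Z3_def red3_def carrier_integer_mod_group\<close>)
qed

theorem theorem6p1:
  fixes p q r :: nat
    and G :: "(int \<times> int \<times> int) monoid"
    and S S0 C :: "(int \<times> int \<times> int) set"
  assumes "prime p" and "prime q" and "prime r"
    and "odd p" and "odd q" and "odd r"
    and "p \<noteq> q" and "p \<noteq> r" and "q \<noteq> r"
    and "G = Z3 p q r"
    and "S \<subset> carrier G - {\<one>\<^bsub>G\<^esub>}"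
    and "generate G S = carrier G"
    and "S0 = S \<union> {\<one>\<^bsub>G\<^esub>}"
    and "\<one>\<^bsub>G\<^esub> \<in> C" and "C \<subseteq> carrier G"
  shows "perfect_code (Cay G S) C \<longleftrightarrow>
       (\<exists>(\<alpha> :: int \<Rightarrow> int) (\<beta> :: int \<Rightarrow> int). \<alpha> 0 = 0 \<and> \<beta> 0 = 0 \<and>
          S0 = {red3 p q r (i, \<alpha> i, \<beta> i) | i. i \<in> idx p} \<and>
          C = {red3 p q r (0, i, j) | i j. i \<in> idx q \<and> j \<in> idx r}) \<or>
       (\<exists>(\<alpha> :: int \<Rightarrow> int) (\<beta> :: int \<Rightarrow> int). \<alpha> 0 = 0 \<and> \<beta> 0 = 0 \<and>
          S0 = {red3 p q r (\<alpha> i, i, \<beta> i) | i. i \<in> idx q} \<and>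
          C = {red3 p q r (i, 0, j) | i j. i \<in> idx p \<and> j \<in> idx r}) \<or>
       (\<exists>(\<alpha> :: int \<Rightarrow> int) (\<beta> :: int \<Rightarrow> int). \<alpha> 0 = 0 \<and> \<beta> 0 = 0 \<and>
          S0 = {red3 p q r (\<alpha> i, \<beta> i, i) | i. i \<in> idx r} \<and>
          C = {red3 p q r (i, j, 0) | i j. i \<in> idx p \<and> j \<in> idx q}) \<or>
       (\<exists>(\<alpha> :: int \<Rightarrow> int) (l :: int \<Rightarrow> int). \<alpha> 0 = 0 \<and> l 0 = 0 \<and>
          S0 = {red3 p q r (j, i, \<alpha> i) | i j. i \<in> idx q \<and> j \<in> idx p} \<and>
          C = {red3 p q r (l i, 0, i) | i. i \<in> idx r}) \<or>
       (\<exists>(\<alpha> :: int \<Rightarrow> int) (l :: int \<Rightarrow> int). \<alpha> 0 = 0 \<and> l 0 = 0 \<and>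
          S0 = {red3 p q r (i, j, \<alpha> i) | i j. i \<in> idx p \<and> j \<in> idx q} \<and>
          C = {red3 p q r (0, l i, i) | i. i \<in> idx r}) \<or>
       (\<exists>(\<alpha> :: int \<Rightarrow> int) (l :: int \<Rightarrow> int). \<alpha> 0 = 0 \<and> l 0 = 0 \<and>
          S0 = {red3 p q r (j, \<alpha> i, i) | i j. i \<in> idx r \<and> j \<in> idx p} \<and>
          C = {red3 p q r (l i, i, 0) | i. i \<in> idx q}) \<or>
       (\<exists>(\<alpha> :: int \<Rightarrow> int) (l :: int \<Rightarrow> int). \<alpha> 0 = 0 \<and> l 0 = 0 \<and>
          S0 = {red3 p q r (i, \<alpha> i, j) | i j. i \<in> idx p \<and> j \<in> idx r} \<and>
          C = {red3 p q r (0, i, l i) | i. i \<in> idx q}) \<or>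
       (\<exists>(\<alpha> :: int \<Rightarrow> int) (l :: int \<Rightarrow> int). \<alpha> 0 = 0 \<and> l 0 = 0 \<and>
          S0 = {red3 p q r (\<alpha> i, j, i) | i j. i \<in> idx r \<and> j \<in> idx q} \<and>
          C = {red3 p q r (i, l i, 0) | i. i \<in> idx p}) \<or>
       (\<exists>(\<alpha> :: int \<Rightarrow> int) (l :: int \<Rightarrow> int). \<alpha> 0 = 0 \<and> l 0 = 0 \<and>
          S0 = {red3 p q r (\<alpha> i, i, j) | i j. i \<in> idx q \<and> j \<in> idx r} \<and>
          C = {red3 p q r (i, 0, l i) | i. i \<in> idx p}) \<or>
       (\<exists>\<alpha> :: int \<Rightarrow> int \<Rightarrow> int. \<alpha> 0 0 = 0 \<and>
          S0 = {red3 p q r (i, j, \<alpha> i j) | i j. i \<in> idx p \<and> j \<in> idx q} \<and>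
          C = {red3 p q r (0, 0, i) | i. i \<in> idx r}) \<or>
       (\<exists>\<alpha> :: int \<Rightarrow> int \<Rightarrow> int. \<alpha> 0 0 = 0 \<and>
          S0 = {red3 p q r (i, \<alpha> i j, j) | i j. i \<in> idx p \<and> j \<in> idx r} \<and>
          C = {red3 p q r (0, i, 0) | i. i \<in> idx q}) \<or>
       (\<exists>\<alpha> :: int \<Rightarrow> int \<Rightarrow> int. \<alpha> 0 0 = 0 \<and>
          S0 = {red3 p q r (\<alpha> i j, i, j) | i j. i \<in> idx q \<and> j \<in> idx r} \<and>
          C = {red3 p q r (i, 0, 0) | i. i \<in> idx p})"
proof -
  \<comment> \<open>One copy of the coordinate system for each prime that may be the size of a factor.\<close>
  interpret three_coordinates G p q r fst "\<lambda>a. fst (snd a)" "\<lambda>a. snd (snd a)"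
      "\<lambda>i j k. red3 p q r (i, j, k)"
    unfolding \<open>G = Z3 p q r\<close> using three_coordinates_Z3 assms by blast
  interpret Y: three_coordinates G q p r "\<lambda>a. fst (snd a)" fst "\<lambda>a. snd (snd a)"
      "\<lambda>j i k. red3 p q r (i, j, k)"
    by (rule transposed)
  interpret Z: three_coordinates G r p q "\<lambda>a. snd (snd a)" fst "\<lambda>a. fst (snd a)"
      "\<lambda>k i j. red3 p q r (i, j, k)"
    by (rule rotated)
  have S: "S \<subseteq> carrier G" using assms by auto
  have one: "\<one>\<^bsub>G\<^esub> \<in> S0" "\<one>\<^bsub>G\<^esub> \<in> C" using assms by auto
  have gen: "\<exists>s\<in>S0. fst s \<noteq> 0" "\<exists>s\<in>S0. fst (snd s) \<noteq> 0" "\<exists>s\<in>S0. snd (snd s) \<noteq> 0"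
    using generating_set_coord Y.generating_set_coord Z.generating_set_coord S assms(12,13)
    by blast+
  have "S0 \<noteq> {\<one>\<^bsub>G\<^esub>}" using gen(1) coords_one by auto
  moreover have "S0 \<noteq> carrier G" using assms(11,13) by auto
  ultimately have cards: "card S0 \<in> {p, q, r} \<or> card C \<in> {p, q, r}" if "tiling G S0 C"
    using tiling_factor_cards[OF that one(1)] by simp
  have "perfect_code (Cay G S) C \<longleftrightarrow> tiling G S0 C"
    using perfect_code_iff_tiling[OF S \<open>C \<subseteq> carrier G\<close>] \<open>S0 = S \<union> {\<one>\<^bsub>G\<^esub>}\<close> by simp
  also have "\<dots> \<longleftrightarrow>
      (tiling G S0 C \<and> card S0 = p) \<or> (tiling G S0 C \<and> card S0 = q) \<or> (tiling G S0 C \<and> card S0 = r) \<or>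
      (tiling G S0 C \<and> card C = p) \<or> (tiling G S0 C \<and> card C = q) \<or> (tiling G S0 C \<and> card C = r)"
    using cards by blast
  finally show ?thesis
    \<comment> \<open>The three primes as sizes of \<open>S0\<close> give cases 1 to 3; each prime as the size of \<open>C\<close> gives
      three of the remaining nine.\<close>
    unfolding tiling_by_prime_generating_set_iff[OF one gen(2,3)]
      Y.tiling_by_prime_generating_set_iff[OF one gen(1,3)]
      Z.tiling_by_prime_generating_set_iff[OF one gen(1,2)]
      tiling_by_prime_code_iff[OF one gen(1)]
      Y.tiling_by_prime_code_iff[OF one gen(2)]
      Z.tiling_by_prime_code_iff[OF one gen(3)]
    by (simp only: disj_ac)
qed

end
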